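(* Let $\mathcal{H}$ be a real Hilbert space, let $K$ be a convex cone in $\mathcal{H}$ such that $K\smallsetminus\{0\}\neq\varnothing$, let $\rho>0$, and let $x\in K^{\ominus}$. Suppose that there exists a nonempty subset $C$ of $K$ such that $\|y\|=\rho$ for every $y\in C$ and $K=\operatorname{pos}C$. Set $$D:=K\cap S(0;\rho)\quad\text{and}\quad \kappa:=\sup_{y\in C}\langle x,y\rangle .$$ Then the following hold: (i) Suppose that $P_Cx=\varnothing$. Then $P_Dx=\varnothing$. (ii) Suppose that $P_Cx\neq\varnothing$, and set $E:=S(0;\rho)\cap\operatorname{cone}(\operatorname{conv}P_Cx)$. Then the following hold: (a) $P_Cx\subseteq P_Dx\subseteq E$ and $\max_{y\in D}\langle x,y\rangle=\max_{y\in C}\langle x,y\rangle$ (both maxima being attained). (b) If $\kappa<0$, then $P_Dx=P_Cx$. (c) If $\kappa=0$, then $P_Dx=E$. (iii) $P_Cx\neq\varnothing$ if and only if $P_Dx\neq\varnothing$.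
   Context: A subset $K$ of $\mathcal{H}$ is a cone if $K=\bigcup_{\lambda>0}\lambda K$. $S(0;\rho)=\{y\in\mathcal{H}:\|y\|=\rho\}$. $K^{\ominus}=\{u\in\mathcal{H}:\sup_{y\in K}\langle u,y\rangle\le 0\}$. For a nonempty set $C$, $\operatorname{pos}C$ is the set of all finite sums $\sum_{i\in I}\alpha_ix_i$ with $I$ finite, $\alpha_i\in[0,+\infty)$ and $x_i\in C$. $\operatorname{conv}$ denotes the convex hull, and $\operatorname{cone}A$ is the smallest cone containing $A$, i.e. $\operatorname{cone}A=\bigcup_{\lambda>0}\lambda A$. For a nonempty subset $C$ of $\mathcal{H}$, the (set-valued, possibly empty-valued) projector is $P_Cx=\{u\in C:\|x-u\|=\inf_{y\in C}\|x-y\|\}$. *)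

theory Defs
  imports "HOL-Analysis.Analysis"
begin

text \<open>The scalars range over the strictly positive reals, so a cone need not contain \<open>0\<close>. This differs
  from the library predicate \<^const>\<open>cone\<close>, which allows the scalar \<open>0\<close>.\<close>

definition cone_gen :: "'a::real_vector set \<Rightarrow> 'a set" where
  "cone_gen A = (\<Union>c\<in>{0<..}. (*\<^sub>R) c ` A)"

definition is_cone :: "'a::real_vector set \<Rightarrow> bool" where
  "is_cone K \<longleftrightarrow> K = (\<Union>c\<in>{0<..}. (*\<^sub>R) c ` K)"

lemma cone_gen_is_smallest_cone: "is_cone hull A = cone_gen A"
proof (rule hull_unique)
  show "A \<subseteq> cone_gen A"
    unfolding cone_gen_def by (force intro: bexI[of _ 1])
  show "is_cone (cone_gen A)"
    unfolding is_cone_def cone_gen_def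
  proof (intro equalityI subsetI)
    fix y assume "y \<in> (\<Union>c\<in>{0::real<..}. (*\<^sub>R) c ` A)"
    then show "y \<in> (\<Union>c\<in>{0::real<..}. (*\<^sub>R) c ` (\<Union>c\<in>{0::real<..}. (*\<^sub>R) c ` A))"
      by (force intro: bexI[of _ 1])
  next
    fix y assume "y \<in> (\<Union>c\<in>{0::real<..}. (*\<^sub>R) c ` (\<Union>c\<in>{0::real<..}. (*\<^sub>R) c ` A))"
    then obtain c d :: real and a where "c > 0" "d > 0" "a \<in> A" "y = (c * d) *\<^sub>R a"
      by auto
    moreover have "c * d \<in> {0<..}"
      using \<open>c > 0\<close> \<open>d > 0\<close> by simp
    ultimately show "y \<in> (\<Union>c\<in>{0::real<..}. (*\<^sub>R) c ` A)"
      by blast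
  qed
  show "cone_gen A \<subseteq> T" if "A \<subseteq> T" "is_cone T" for T
    using that unfolding cone_gen_def is_cone_def by blast
qed

text \<open>The supremum is taken in the extended reals: \<open>\<langle>u,y\<rangle>\<close> may be unbounded above on \<open>K\<close>, and the
  supremum over a set unbounded above is unspecified in \<^typ>\<open>real\<close>.\<close>

definition polar_cone :: "'a::real_inner set \<Rightarrow> 'a set" where
  "polar_cone K = {u. (SUP y\<in>K. ereal (inner u y)) \<le> 0}"

definition pos :: "'a::real_vector set \<Rightarrow> 'a set" where
  "pos C = {\<Sum>i\<in>I. a i *\<^sub>R z i | (I :: nat set) a z. finite I \<and> (\<forall>i\<in>I. 0 \<le> a i \<and> z i \<in> C)}"

definition projector :: "'a::real_normed_vector set \<Rightarrow> 'a \<Rightarrow> 'a set" where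
  "projector C x = {u \<in> C. norm (x - u) = (INF y\<in>C. norm (x - y))}"

end

theory Submission
  imports Defs
begin

text \<open>
  On a set of vectors of norm \<open>\<rho>\<close> we have \<open>\<parallel>x - y\<parallel>\<^sup>2 = \<parallel>x\<parallel>\<^sup>2 + \<rho>\<^sup>2 - 2\<langle>x,y\<rangle>\<close>, so projecting \<open>x\<close> means
  maximising the linear form \<open>\<langle>x,\<cdot>\<rangle>\<close> (\<open>projector_on_sphere\<close>). The whole theorem therefore
  compares the maximisers of \<open>\<langle>x,\<cdot>\<rangle>\<close> over \<open>C\<close> and over \<open>D\<close>.

  The comparison rests on one observation. If \<open>y = \<Sum>i. a i *\<^sub>R z i\<close> has norm \<open>\<rho>\<close>, with nonnegative
  coefficients and all \<open>z i\<close> of norm \<open>\<rho>\<close>, then the triangle inequality gives \<open>\<Sum>i. a i \<ge> 1\<close>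
  (\<open>sum_coeffs_ge_1\<close>). The form \<open>\<langle>x,\<cdot>\<rangle>\<close> is nonpositive on \<open>K\<close>, since \<open>x\<close> lies in the polar cone.
  Scaling a nonpositive bound \<open>m\<close> by a factor at least \<open>1\<close> can only lower it, so
  \<open>\<langle>x,y\<rangle> \<le> m * (\<Sum>i. a i) \<le> m\<close>: a nonpositive bound of \<open>\<langle>x,\<cdot>\<rangle>\<close> on \<open>C\<close> is a bound on \<open>D\<close>
  (\<open>inner_le_on_pos_sphere\<close>). Hence a maximiser over \<open>C\<close> is one over \<open>D\<close>.

  Conversely, let \<open>u\<close> maximise over \<open>D\<close>, with value \<open>m\<close>. As \<open>C \<subseteq> D\<close>, the chain above, for
  \<open>y = u\<close>, starts and ends at \<open>m\<close>, so both inequalities are equalities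
  (\<open>maximiser_decomposition\<close>). The first says that every \<open>z i\<close> that occurs in \<open>u\<close> with a positive
  coefficient is itself a maximiser over \<open>C\<close>; this shows existence of one and puts \<open>u\<close> in the cone
  over the convex hull of these maximisers. The second says that \<open>m = 0\<close> or the coefficients sum to
  \<open>1\<close>. If \<open>m < 0\<close>, then \<open>u\<close> is a convex combination of points of its own sphere, and strict
  convexity of the ball (\<open>convex_combination_on_sphere\<close>) forces \<open>u\<close> to be one of them. If
  \<open>m = 0\<close>, then \<open>\<langle>x,\<cdot>\<rangle>\<close> vanishes on the whole cone over the convex hull of the maximisers. This
  cone lies in the convex cone \<open>K\<close>, so each of its points of norm \<open>\<rho>\<close> is a maximiser over \<open>D\<close>.
\<close>

section \<open>Projections as maximisers of a linear form\<close>

lemma projector_on_sphere: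
  fixes x :: "'a::real_inner"
  assumes "\<forall>y\<in>S. norm y = r"
  shows "projector S x = {u\<in>S. \<forall>y\<in>S. inner x y \<le> inner x u}"
proof -
  have bdd: "bdd_below ((\<lambda>y. norm (x - y)) ` S)"
    by (rule bdd_belowI[of _ 0]) auto
  have "norm (x - u) = (INF y\<in>S. norm (x - y)) \<longleftrightarrow> (\<forall>y\<in>S. inner x y \<le> inner x u)"
    if u: "u \<in> S" for u
  proof -
    have le_iff: "norm (x - u) \<le> norm (x - y) \<longleftrightarrow> inner x y \<le> inner x u" if "y \<in> S" for y
    proof -
      have "u \<bullet> u = y \<bullet> y"
        using assms u that by (simp add: dot_square_norm)
      then show ?thesis
        by (simp add: norm_le inner_diff inner_commute)
    qed
    have "norm (x - u) = (INF y\<in>S. norm (x - y)) \<longleftrightarrow> (\<forall>y\<in>S. norm (x - u) \<le> norm (x - y))"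
    proof
      assume "norm (x - u) = (INF y\<in>S. norm (x - y))"
      then show "\<forall>y\<in>S. norm (x - u) \<le> norm (x - y)"
        using cINF_lower[OF bdd] by simp
    next
      assume "\<forall>y\<in>S. norm (x - u) \<le> norm (x - y)"
      then show "norm (x - u) = (INF y\<in>S. norm (x - y))"
        using u by (intro cInf_eq_minimum[symmetric]) auto
    qed
    then show ?thesis
      using le_iff by simp
  qed
  then show ?thesis
    unfolding projector_def by auto
qed

lemma polar_cone_inner_le_0:
  assumes "x \<in> polar_cone K" "y \<in> K"
  shows "inner x y \<le> 0"
proof -
  have "ereal (inner x y) \<le> (SUP y\<in>K. ereal (inner x y))"
    using assms(2) by (rule SUP_upper)
  also have "\<dots> \<le> 0"
    using assms(1) by (simp add: polar_cone_def)
  finally show ?thesis by simp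
qed

section \<open>Nonnegative combinations on a sphere\<close>

lemma sum_coeffs_ge_1:
  fixes z :: "'i \<Rightarrow> 'a::real_normed_vector"
  assumes "\<And>i. i \<in> I \<Longrightarrow> 0 \<le> a i" "\<And>i. i \<in> I \<Longrightarrow> norm (z i) = r"
    and "norm (\<Sum>i\<in>I. a i *\<^sub>R z i) = r" "r > 0"
  shows "1 \<le> sum a I"
proof -
  have "1 * r \<le> (\<Sum>i\<in>I. norm (a i *\<^sub>R z i))"
    using norm_sum[of "\<lambda>i. a i *\<^sub>R z i" I] assms(3) by simp
  also have "\<dots> = sum a I * r"
    using assms(1,2) by (simp add: sum_distrib_right)
  finally show ?thesis
    using \<open>r > 0\<close> by simp
qed

lemma inner_le_on_pos_sphere:
  fixes x :: "'a::real_inner"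
  assumes "\<forall>z\<in>C. norm z = r" "r > 0" "y \<in> pos C" "norm y = r"
    and "m \<le> 0" "\<forall>z\<in>C. inner x z \<le> m"
  shows "inner x y \<le> m"
proof -
  obtain I :: "nat set" and a z
    where I: "\<And>i. i \<in> I \<Longrightarrow> 0 \<le> a i" "\<And>i. i \<in> I \<Longrightarrow> z i \<in> C"
      and y: "y = (\<Sum>i\<in>I. a i *\<^sub>R z i)"
    using assms(3) unfolding pos_def by blast
  have "1 \<le> sum a I"
    using I assms(1,2,4) by (intro sum_coeffs_ge_1[of I a z r]) (auto simp: y)
  have "inner x y = (\<Sum>i\<in>I. a i * inner x (z i))"
    by (simp add: y inner_sum_right)
  also have "\<dots> \<le> (\<Sum>i\<in>I. a i * m)"
    using I assms(6) by (intro sum_mono mult_left_mono) auto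
  also have "\<dots> = sum a I * m"
    by (simp add: sum_distrib_right)
  also have "\<dots> \<le> 1 * m"
    using \<open>1 \<le> sum a I\<close> \<open>m \<le> 0\<close> by (rule mult_right_mono_neg)
  finally show ?thesis by simp
qed

text \<open>The equality case of the previous bound. Dropping the zero coefficients leaves a
  representation all of whose points attain the bound, because a sum of nonnegative gaps
  \<open>a i * (m - \<langle>x, z i\<rangle>)\<close> with total at most \<open>0\<close> has only zero terms.\<close>

lemma maximiser_decomposition:
  fixes x :: "'a::real_inner"
  assumes "\<forall>z\<in>C. norm z = r" "r > 0" "u \<in> pos C" "norm u = r"
    and "inner x u \<le> 0" "\<forall>z\<in>C. inner x z \<le> inner x u"
  obtains I :: "nat set" and a z where
    "finite I" "\<And>i. i \<in> I \<Longrightarrow> 0 < a i" "\<And>i. i \<in> I \<Longrightarrow> z i \<in> C"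
    "\<And>i. i \<in> I \<Longrightarrow> inner x (z i) = inner x u"
    "u = (\<Sum>i\<in>I. a i *\<^sub>R z i)" "1 \<le> sum a I" "inner x u < 0 \<Longrightarrow> sum a I = 1"
proof -
  let ?m = "inner x u"
  obtain J :: "nat set" and a z
    where J: "finite J" "\<And>i. i \<in> J \<Longrightarrow> 0 \<le> a i" "\<And>i. i \<in> J \<Longrightarrow> z i \<in> C"
      and uJ: "u = (\<Sum>i\<in>J. a i *\<^sub>R z i)"
    using assms(3) unfolding pos_def by blast
  define I where "I = {i\<in>J. 0 < a i}"
  have I: "finite I" "\<And>i. i \<in> I \<Longrightarrow> 0 < a i" "\<And>i. i \<in> I \<Longrightarrow> z i \<in> C"
    using J by (auto simp: I_def)
  have u: "u = (\<Sum>i\<in>I. a i *\<^sub>R z i)"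
    unfolding uJ using J(1,2)
    by (intro sum.mono_neutral_right) (force simp: I_def)+
  have ge_1: "1 \<le> sum a I"
    using I assms(1,2,4) u by (intro sum_coeffs_ge_1[of I a z r]) (auto simp: less_imp_le)
  have gap: "(\<Sum>i\<in>I. a i * (?m - inner x (z i))) = (sum a I - 1) * ?m"
  proof -
    have "?m = (\<Sum>i\<in>I. a i * inner x (z i))"
      by (subst u) (simp add: inner_sum_right)
    then show ?thesis
      by (simp add: right_diff_distrib sum_subtractf sum_distrib_right left_diff_distrib)
  qed
  have gap_nonneg: "0 \<le> a i * (?m - inner x (z i))" if "i \<in> I" for i
    using I(2,3)[OF that] assms(6) by (simp add: less_imp_le)
  have "(sum a I - 1) * ?m \<le> 0"
    using ge_1 assms(5) by (simp add: mult_nonneg_nonpos)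
  then have gap_0: "(\<Sum>i\<in>I. a i * (?m - inner x (z i))) = 0"
    using sum_nonneg[of I "\<lambda>i. a i * (?m - inner x (z i))"] gap gap_nonneg
    by (intro antisym) auto
  have "inner x (z i) = ?m" if "i \<in> I" for i
    using gap_0 sum_nonneg_eq_0_iff[OF I(1) gap_nonneg] I(2)[OF that] that by fastforce
  moreover have "sum a I = 1" if "?m < 0"
    using gap gap_0 that by simp
  ultimately show thesis
    using that[of I a z] I u ge_1 by blast
qed

text \<open>Strict convexity of the Hilbert ball. Pairing \<open>u\<close> with itself writes \<open>r\<^sup>2\<close> as a weighted mean of
  the numbers \<open>\<langle>u, z i\<rangle>\<close>, each of which is at most \<open>r\<^sup>2\<close>; equality in Cauchy-Schwarz then holds
  for each of them.\<close>

lemma convex_combination_on_sphere: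
  fixes z :: "'i \<Rightarrow> 'a::real_inner"
  assumes "finite I" "\<And>i. i \<in> I \<Longrightarrow> 0 < a i" "sum a I = 1"
    and "\<And>i. i \<in> I \<Longrightarrow> norm (z i) = r" "u = (\<Sum>i\<in>I. a i *\<^sub>R z i)" "norm u = r"
    and "i \<in> I"
  shows "z i = u"
proof -
  have dist_sq: "(norm (z j - u))\<^sup>2 = 2 * (r\<^sup>2 - inner u (z j))" if "j \<in> I" for j
  proof -
    have "z j \<bullet> z j = r\<^sup>2" "u \<bullet> u = r\<^sup>2"
      using assms(4)[OF that] assms(6) by (simp_all add: dot_square_norm)
    then show ?thesis
      by (simp add: power2_norm_eq_inner inner_diff inner_commute)
  qed
  have nonneg: "0 \<le> a j * (r\<^sup>2 - inner u (z j))" if "j \<in> I" for j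
  proof -
    have "0 \<le> 2 * (r\<^sup>2 - inner u (z j))"
      using dist_sq[OF that, symmetric] by simp
    then show ?thesis
      using assms(2)[OF that] by simp
  qed
  have "r\<^sup>2 = inner u (\<Sum>j\<in>I. a j *\<^sub>R z j)"
    using assms(5,6) by (simp add: power2_norm_eq_inner[symmetric])
  then have "(\<Sum>j\<in>I. a j * (r\<^sup>2 - inner u (z j))) = 0"
    using assms(3)
    by (simp add: inner_sum_right right_diff_distrib sum_subtractf flip: sum_distrib_right)
  then have "a i * (r\<^sup>2 - inner u (z i)) = 0"
    using sum_nonneg_eq_0_iff[OF assms(1) nonneg] assms(7) by simp
  then show ?thesis
    using dist_sq[OF assms(7)] assms(2)[OF assms(7)] by simp
qed

section \<open>The cone over a convex hull\<close>

lemma sum_in_cone_gen_convex_hull: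
  assumes "finite I" "\<And>i. i \<in> I \<Longrightarrow> 0 \<le> a i" "\<And>i. i \<in> I \<Longrightarrow> z i \<in> A" "0 < sum a I"
  shows "(\<Sum>i\<in>I. a i *\<^sub>R z i) \<in> cone_gen (convex hull A)"
proof -
  let ?s = "sum a I"
  let ?w = "\<Sum>i\<in>I. (a i / ?s) *\<^sub>R z i"
  have "?w \<in> convex hull A"
    using assms by (intro convex_sum convex_convex_hull)
      (auto simp: hull_inc simp flip: sum_divide_distrib)
  moreover have "(\<Sum>i\<in>I. a i *\<^sub>R z i) = ?s *\<^sub>R ?w"
    using assms(4) by (simp add: scaleR_sum_right)
  ultimately show ?thesis
    using assms(4) unfolding cone_gen_def by blast
qed

lemma cone_gen_convex_hull_subset:
  assumes "convex K" "is_cone K" "A \<subseteq> K"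
  shows "cone_gen (convex hull A) \<subseteq> K"
proof -
  have "convex hull A \<subseteq> K"
    using assms(1,3) by (simp add: hull_minimal)
  then show ?thesis
    using assms(2) unfolding is_cone_def cone_gen_def by blast
qed

lemma inner_eq_0_on_cone_gen_convex_hull:
  fixes x :: "'a::real_inner"
  assumes "\<And>y. y \<in> A \<Longrightarrow> inner x y = 0" "e \<in> cone_gen (convex hull A)"
  shows "inner x e = 0"
proof -
  have "convex hull A \<subseteq> {y. inner x y = 0}"
    using assms(1) by (intro hull_minimal convex_hyperplane) auto
  then show ?thesis
    using assms(2) unfolding cone_gen_def by auto
qed

section \<open>Projecting onto the spherical section of a cone\<close>

theorem theorem8p5:
  fixes K C D E :: "'a::{real_inner, complete_space} set"
    and x :: 'a
    and \<rho> \<kappa> :: real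
  assumes "convex K" and "is_cone K" and "K - {0} \<noteq> {}"
    and "\<rho> > 0"
    and "x \<in> polar_cone K"
    and "C \<noteq> {}" and "C \<subseteq> K" and "\<forall>y\<in>C. norm y = \<rho>" and "K = pos C"
    and D: "D = K \<inter> sphere 0 \<rho>"
    and \<kappa>: "\<kappa> = (SUP y\<in>C. inner x y)"
    and E: "E = sphere 0 \<rho> \<inter> cone_gen (convex hull (projector C x))"
  shows
    "(projector C x = {} \<longrightarrow> projector D x = {}) \<and>
     (projector C x \<noteq> {} \<longrightarrow>
        (projector C x \<subseteq> projector D x \<and> projector D x \<subseteq> E \<and>
         (\<exists>u v. is_arg_max (inner x) (\<lambda>y. y \<in> D) u \<and> is_arg_max (inner x) (\<lambda>y. y \<in> C) v \<and>
                inner x u = inner x v)) \<and>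
        (\<kappa> < 0 \<longrightarrow> projector D x = projector C x) \<and>
        (\<kappa> = 0 \<longrightarrow> projector D x = E)) \<and>
     (projector C x \<noteq> {} \<longleftrightarrow> projector D x \<noteq> {})"
proof -
  have norm_C: "\<forall>y\<in>C. norm y = \<rho>" and norm_D: "\<forall>y\<in>D. norm y = \<rho>"
    using assms(8) D by auto
  have CD: "C \<subseteq> D"
    using assms(7,8) D by auto
  have nonpos: "inner x y \<le> 0" if "y \<in> K" for y
    using assms(5) that by (rule polar_cone_inner_le_0)
  note PC = projector_on_sphere[OF norm_C, of x]
  note PD = projector_on_sphere[OF norm_D, of x]

  have PC_PD: "projector C x \<subseteq> projector D x"
  proof
    fix v assume "v \<in> projector C x"
    then have v: "v \<in> C" "\<forall>y\<in>C. inner x y \<le> inner x v"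
      by (auto simp: PC)
    have "inner x y \<le> inner x v" if "y \<in> D" for y
    proof (rule inner_le_on_pos_sphere[OF norm_C \<open>\<rho> > 0\<close>])
      show "y \<in> pos C" "norm y = \<rho>"
        using that D \<open>K = pos C\<close> by auto
      show "inner x v \<le> 0"
        using v(1) assms(7) nonpos by blast
    qed (use v(2) in blast)
    then show "v \<in> projector D x"
      using v CD by (auto simp: PD)
  qed

  have max_D: "u \<in> E \<and> projector C x \<noteq> {} \<and> (inner x u < 0 \<longrightarrow> u \<in> projector C x)"
    if "u \<in> projector D x" for u
  proof -
    have "u \<in> D" and "\<forall>y\<in>D. inner x y \<le> inner x u"
      using that by (auto simp: PD)
    then have "u \<in> K" and u: "norm u = \<rho>" "\<forall>y\<in>C. inner x y \<le> inner x u"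
      using norm_D CD D by blast+
    have "u \<in> pos C" "inner x u \<le> 0"
      using \<open>u \<in> K\<close> assms(9) nonpos by blast+
    obtain I :: "nat set" and a z where
      I: "finite I" "\<And>i. i \<in> I \<Longrightarrow> 0 < a i" "\<And>i. i \<in> I \<Longrightarrow> z i \<in> C"
        "\<And>i. i \<in> I \<Longrightarrow> inner x (z i) = inner x u"
        "u = (\<Sum>i\<in>I. a i *\<^sub>R z i)" "1 \<le> sum a I" "inner x u < 0 \<Longrightarrow> sum a I = 1"
      using maximiser_decomposition
          [OF norm_C \<open>\<rho> > 0\<close> \<open>u \<in> pos C\<close> u(1) \<open>inner x u \<le> 0\<close> u(2)] by blast
    have z: "z i \<in> projector C x" if "i \<in> I" for i
      using I(3,4)[OF that] u(2) by (simp add: PC)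
    have "u \<in> cone_gen (convex hull (projector C x))"
      unfolding I(5) using I(1,2,6) z
      by (intro sum_in_cone_gen_convex_hull) (auto simp: less_imp_le)
    then have "u \<in> E"
      using u(1) by (simp add: E)
    obtain i where i: "i \<in> I"
      using I(6) by fastforce
    have "u \<in> projector C x" if "inner x u < 0"
    proof -
      have "z i = u"
        using I norm_C u(1) that i by (intro convex_combination_on_sphere[of I a z \<rho>]) auto
      then show ?thesis
        using z[OF i] by simp
    qed
    then show ?thesis
      using \<open>u \<in> E\<close> z[OF i] by blast
  qed

  have \<kappa>_max: "inner x v = \<kappa>" if "v \<in> projector D x" "projector C x \<noteq> {}" for v
  proof -
    obtain w where w: "w \<in> projector C x"
      using \<open>projector C x \<noteq> {}\<close> by blast
    then have "\<kappa> = inner x w"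
      unfolding \<kappa> by (intro cSup_eq_maximum) (auto simp: PC)
    moreover have "inner x w = inner x v"
      using w PC_PD that(1) by (intro antisym) (auto simp: PD)
    ultimately show ?thesis by simp
  qed

  have "\<exists>u v. is_arg_max (inner x) (\<lambda>y. y \<in> D) u \<and> is_arg_max (inner x) (\<lambda>y. y \<in> C) v \<and>
          inner x u = inner x v" if ne: "projector C x \<noteq> {}"
  proof -
    obtain v where v: "v \<in> projector C x" "v \<in> projector D x"
      using ne PC_PD by blast
    then have "is_arg_max (inner x) (\<lambda>y. y \<in> D) v" "is_arg_max (inner x) (\<lambda>y. y \<in> C) v"
      by (auto simp: PC PD is_arg_max_def not_less)
    then show ?thesis by blast
  qed
  moreover have "projector D x = projector C x" if "projector C x \<noteq> {}" "\<kappa> < 0"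
    using PC_PD max_D \<kappa>_max that by blast
  moreover have "projector D x = E" if ne: "projector C x \<noteq> {}" and "\<kappa> = 0"
  proof
    show "projector D x \<subseteq> E"
      using max_D by blast
    show "E \<subseteq> projector D x"
    proof
      fix e assume "e \<in> E"
      then have e: "norm e = \<rho>" "e \<in> cone_gen (convex hull (projector C x))"
        by (auto simp: E)
      have "inner x v = 0" if "v \<in> projector C x" for v
        using \<kappa>_max[of v] that PC_PD ne \<open>\<kappa> = 0\<close> by blast
      then have "inner x e = 0"
        using e(2) by (rule inner_eq_0_on_cone_gen_convex_hull)
      moreover have "e \<in> K"
        using cone_gen_convex_hull_subset[OF assms(1,2), of "projector C x"] assms(7) e(2)
        by (auto simp: PC)
      ultimately show "e \<in> projector D x"
        using e(1) nonpos unfolding PD by (simp add: D)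
    qed
  qed
  ultimately show ?thesis
    using PC_PD max_D by blast
qed

end
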